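(* Let $n\ge 3$ and let $M$ be an affine quasi-umbilical hypersurface in $\mathbb{A}^{n+1}$, with the condition $$\mathrm{rank}(S-\rho\,h)=1,\qquad \rho=\rho(x)\in\mathbb{R},$$ satisfied at every point $x\in M$. Then $$R^{\ast}\cdot R^{\ast}=L\,Q(h,R^{\ast})$$ holds on $M$, where the function $L$ is defined by $L=L(x)=\rho\,(\mathrm{tr}_h(\mathcal{S})-(n-1)\rho)$. Moreover, if $\rho\neq 0$ at $x$, then at this point $$\mathrm{rank}\bigl(\mathrm{Ric}(R^{\ast})-\rho(\mathrm{tr}_h(\mathcal{S})-\rho)\,h\bigr)=\mathrm{rank}(S-\rho\,h)=1 .$$
   Context: $\mathbb{A}^{n+1}$ is $\mathbb{R}^{n+1}$ with its standard flat connection and the volume form given by the determinant. A hypersurface $M\subset\mathbb{A}^{n+1}$ (connected, smooth) is non-degenerate if its affine fundamental form is non-degenerate; it then carries its affine normal $\xi$, the Blaschke-Berwald metric $h$ (a semi-Riemannian metric), the induced connection $\nabla$ and the affine shape operator $\mathcal{S}$ (Gauss and Weingarten formulas $\widetilde\nabla_XY=\nabla_XY+h(X,Y)\xi$, $\widetilde\nabla_X\xi=-\mathcal{S}X$); the operator $\mathcal{S}$ is $h$-self-adjoint. Hypersurfaces are assumed non-degenerate. A non-degenerate hypersurface $M$ is affine quasi-umbilical at a point $x$ (at which $\mathcal{S}_x$ is not a multiple of the identity) if $\mathrm{rank}(S-\rho h)=1$ at $x$ for some $\rho\in\mathbb{R}$. Set $S(X,Y)=h(X,\mathcal{S}Y)$,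 and let $\mathrm{tr}_h(\mathcal{S})$ be the trace of $\mathcal{S}$. For symmetric $(0,2)$-tensors $E,F$ the Kulkarni-Nomizu product is $(E\wedge F)(X_1,X_2,X_3,X_4)=E(X_1,X_4)F(X_2,X_3)+E(X_2,X_3)F(X_1,X_4)-E(X_1,X_3)F(X_2,X_4)-E(X_2,X_4)F(X_1,X_3)$. The Opozda-Verstraelen affine curvature tensor is $R^{\ast}=\frac12 S\wedge S$. Its Ricci tensor is $\mathrm{Ric}(R^{\ast})(X,Y)=\sum_j\varepsilon_jR^{\ast}(e_j,X,Y,e_j)$, where $(e_j)$ is an $h$-orthonormal basis and $h(e_j,e_j)=\varepsilon_j=\pm1$. For a $(0,4)$-tensor $B$ with the algebraic symmetries of a curvature tensor, let $\mathcal{B}(X,Y)$ be the endomorphism with $h(\mathcal{B}(X_1,X_2)X_3,X_4)=B(X_1,X_2,X_3,X_4)$. For a $(0,k)$-tensor $T$, $(B\cdot T)(X_1,\dots,X_k,X,Y)=-\sum_{i=1}^{k}T(X_1,\dots,\mathcal{B}(X,Y)X_i,\dots,X_k)$. For a symmetric $(0,2)$-tensor $A$, let $(X\wedge_AY)Z=A(Y,Z)X-A(X,Z)Y$ and $Q(A,T)(X_1,\dots,X_k,X,Y)=-\sum_{i=1}^{k}T(X_1,\dots,(X\wedge_AY)X_i,\dots,X_k)$. *)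

theory Defs
  imports "HOL-Analysis.Analysis"
begin

section \<open>Smooth hypersurfaces of affine space\<close>

text \<open>
  The affine space of dimension n + 1 is \<open>real^('n option)\<close> with n = \<open>CARD('n)\<close>; its flat
  connection is componentwise differentiation and its volume form is \<open>det\<close>.
\<close>

type_synonym 'n affine_space = "real ^ ('n option)"

abbreviation dir_deriv ::
  "('a::real_normed_vector \<Rightarrow> 'b::real_normed_vector) \<Rightarrow> 'a \<Rightarrow> 'a \<Rightarrow> 'b" where
  "dir_deriv f u X \<equiv> frechet_derivative f (at u) X"

fun Ck_on :: "nat \<Rightarrow> ('a::real_normed_vector \<Rightarrow> 'b::real_normed_vector) \<Rightarrow> 'a set \<Rightarrow> bool" where
  "Ck_on 0 f U \<longleftrightarrow> continuous_on U f"
| "Ck_on (Suc k) f U \<longleftrightarrow> f differentiable_on U \<and> (\<forall>X. Ck_on k (\<lambda>u. dir_deriv f u X) U)"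

text \<open>Only used on open sets \<open>U\<close>, where \<open>at u within U\<close> and \<open>at u\<close> coincide.\<close>

definition smooth_on ::
  "('a::real_normed_vector \<Rightarrow> 'b::real_normed_vector) \<Rightarrow> 'a set \<Rightarrow> bool" where
  "smooth_on f U \<longleftrightarrow> (\<forall>k. Ck_on k f U)"

definition local_parametrization ::
  "('n::finite) affine_space set \<Rightarrow> (real^'n) set \<Rightarrow> (real^'n \<Rightarrow> 'n affine_space) \<Rightarrow> bool" where
  "local_parametrization M U f \<longleftrightarrow>
     open U \<and> openin (top_of_set M) (f ` U) \<and> (\<exists>g. homeomorphism U (f ` U) f g) \<and>
     smooth_on f U \<and> (\<forall>u\<in>U. inj (dir_deriv f u))"

definition hypersurface :: "('n::finite) affine_space set \<Rightarrow> bool" where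
  "hypersurface M \<longleftrightarrow>
     M \<noteq> {} \<and> connected M \<and> (\<forall>x\<in>M. \<exists>U f. local_parametrization M U f \<and> x \<in> f ` U)"

text \<open>
  \<open>f\<close> is a local parametrization near \<open>x = f u\<close>.  The tangent space of \<open>M\<close> at \<open>x\<close> is
  \<open>range (dir_deriv f u)\<close>; below it is identified with \<open>real^'n\<close> by means of
  \<open>dir_deriv f u\<close>, so that tensors at \<open>x\<close> become tensors on \<open>real^'n\<close>.
\<close>

definition parametrized_at ::
  "('n::finite) affine_space set \<Rightarrow> 'n affine_space \<Rightarrow> (real^'n \<Rightarrow> 'n affine_space) \<Rightarrow> real^'n \<Rightarrow> bool"
  where
  "parametrized_at M x f u \<longleftrightarrow> (\<exists>U. local_parametrization M U f \<and> u \<in> U \<and> f u = x)"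


section \<open>Affine fundamental form, affine normal, shape operator\<close>

text \<open>
  Gauss formula for a vector \<open>\<zeta>\<close> transversal to \<open>M\<close> at \<open>f u\<close>.  The tangent vector \<open>Y\<close> is extended to
  the tangent field with constant coordinates \<open>Y\<close>; the vector \<open>Z\<close> is the induced covariant
  derivative of this field in direction \<open>X\<close>.
\<close>

definition affine_fundamental_form ::
  "(real^('n::finite) \<Rightarrow> 'n affine_space) \<Rightarrow> 'n affine_space \<Rightarrow> real^'n \<Rightarrow> real^'n \<Rightarrow> real^'n \<Rightarrow> real"
  where
  "affine_fundamental_form f \<zeta> u X Y =
     (THE c. \<exists>Z. dir_deriv (\<lambda>v. dir_deriv f v Y) u X = dir_deriv f u Z + c *\<^sub>R \<zeta>)"

definition nondegenerate_form :: "(real^('n::finite) \<Rightarrow> real^'n \<Rightarrow> real) \<Rightarrow> bool" where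
  "nondegenerate_form h \<longleftrightarrow> (\<forall>X. (\<forall>Y. h X Y = 0) \<longrightarrow> X = 0)"

text \<open>
  Changing the transversal vector multiplies the affine fundamental form by a nonzero factor, so
  non-degeneracy does not depend on it.
\<close>

definition nondegenerate_hypersurface :: "('n::finite) affine_space set \<Rightarrow> bool" where
  "nondegenerate_hypersurface M \<longleftrightarrow> hypersurface M \<and>
     (\<forall>x\<in>M. \<forall>f u \<zeta>. parametrized_at M x f u \<longrightarrow> \<zeta> \<notin> range (dir_deriv f u) \<longrightarrow>
        nondegenerate_form (affine_fundamental_form f \<zeta> u))"

definition blaschke_metric ::
  "('n affine_space \<Rightarrow> 'n affine_space) \<Rightarrow> (real^('n::finite) \<Rightarrow> 'n affine_space) \<Rightarrow>
     real^'n \<Rightarrow> real^'n \<Rightarrow> real^'n \<Rightarrow> real" where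
  "blaschke_metric \<xi> f u = affine_fundamental_form f (\<xi> (f u)) u"

text \<open>
  The affine normal field: it is smooth and transversal, its derivatives are tangent to \<open>M\<close>, and
  the induced volume form \<open>\<theta> (X\<^sub>1, \<dots>, X\<^sub>n) = det (X\<^sub>1, \<dots>, X\<^sub>n, \<xi>)\<close> agrees up to sign with
  the volume form of the induced metric \<open>h\<close>, i.e. \<open>\<theta> (X\<^sub>1, \<dots>, X\<^sub>n)\<^sup>2 = \<bar>det (h (X\<^sub>i, X\<^sub>j))\<bar>\<close>.
  These conditions determine it up to sign; either choice is allowed.
\<close>

definition affine_normal ::
  "('n::finite) affine_space set \<Rightarrow> ('n affine_space \<Rightarrow> 'n affine_space) \<Rightarrow> bool" where
  "affine_normal M \<xi> \<longleftrightarrow>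
     (\<forall>U f. local_parametrization M U f \<longrightarrow>
        smooth_on (\<xi> \<circ> f) U \<and>
        (\<forall>u\<in>U.
           \<xi> (f u) \<notin> range (dir_deriv f u) \<and>
           (\<forall>X. dir_deriv (\<xi> \<circ> f) u X \<in> range (dir_deriv f u)) \<and>
           (\<forall>X :: 'n \<Rightarrow> real^'n.
              (det (\<chi> i. case i of None \<Rightarrow> \<xi> (f u) | Some j \<Rightarrow> dir_deriv f u (X j)))\<^sup>2
              = \<bar>det (\<chi> i j. blaschke_metric \<xi> f u (X i) (X j))\<bar>)))"

definition shape_operator ::
  "('n affine_space \<Rightarrow> 'n affine_space) \<Rightarrow> (real^('n::finite) \<Rightarrow> 'n affine_space) \<Rightarrow>
     real^'n \<Rightarrow> real^'n \<Rightarrow> real^'n" where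
  "shape_operator \<xi> f u X = (THE Z. dir_deriv (\<xi> \<circ> f) u X = - dir_deriv f u Z)"

definition shape_form ::
  "('n affine_space \<Rightarrow> 'n affine_space) \<Rightarrow> (real^('n::finite) \<Rightarrow> 'n affine_space) \<Rightarrow>
     real^'n \<Rightarrow> real^'n \<Rightarrow> real^'n \<Rightarrow> real" where
  "shape_form \<xi> f u X Y = blaschke_metric \<xi> f u X (shape_operator \<xi> f u Y)"


section \<open>Tensor algebra on a tangent space\<close>

type_synonym 'v tensor2 = "'v \<Rightarrow> 'v \<Rightarrow> real"
type_synonym 'v tensor4 = "'v \<Rightarrow> 'v \<Rightarrow> 'v \<Rightarrow> 'v \<Rightarrow> real"
type_synonym 'v tensor6 = "'v \<Rightarrow> 'v \<Rightarrow> 'v \<Rightarrow> 'v \<Rightarrow> 'v \<Rightarrow> 'v \<Rightarrow> real"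

definition form_rank :: "(real^('n::finite)) tensor2 \<Rightarrow> nat" where
  "form_rank B = rank (\<chi> i j. B (axis i 1) (axis j 1) :: real^'n^'n)"

definition kulkarni_nomizu :: "'v tensor2 \<Rightarrow> 'v tensor2 \<Rightarrow> 'v tensor4" where
  "kulkarni_nomizu E F X1 X2 X3 X4 =
     E X1 X4 * F X2 X3 + E X2 X3 * F X1 X4 - E X1 X3 * F X2 X4 - E X2 X4 * F X1 X3"

text \<open>For a non-degenerate bilinear form \<open>h\<close>, \<open>n\<close> such vectors automatically form a basis.\<close>

definition orthonormal_basis ::
  "(real^('n::finite)) tensor2 \<Rightarrow> ('n \<Rightarrow> real^'n) \<Rightarrow> bool" where
  "orthonormal_basis h e \<longleftrightarrow>
     (\<forall>i. h (e i) (e i) = 1 \<or> h (e i) (e i) = -1) \<and> (\<forall>i j. i \<noteq> j \<longrightarrow> h (e i) (e j) = 0)"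

text \<open>The sum does not depend on the choice of the \<open>h\<close>-orthonormal basis.\<close>

definition ricci :: "(real^('n::finite)) tensor2 \<Rightarrow> (real^'n) tensor4 \<Rightarrow> (real^'n) tensor2" where
  "ricci h B X Y =
     (let e = (SOME e. orthonormal_basis h e)
      in \<Sum>j\<in>UNIV. h (e j) (e j) * B (e j) X Y (e j))"

definition curvature_endo :: "'v tensor2 \<Rightarrow> 'v tensor4 \<Rightarrow> 'v \<Rightarrow> 'v \<Rightarrow> 'v \<Rightarrow> 'v" where
  "curvature_endo h B X1 X2 X3 = (THE W. \<forall>X4. h W X4 = B X1 X2 X3 X4)"

definition wedge_endo :: "('v::real_vector) tensor2 \<Rightarrow> 'v \<Rightarrow> 'v \<Rightarrow> 'v \<Rightarrow> 'v" where
  "wedge_endo A X Y Z = A Y Z *\<^sub>R X - A X Z *\<^sub>R Y"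

text \<open>The (0,6)-tensors \<open>B \<cdot> T\<close> and \<open>Q(A,T)\<close> for a (0,4)-tensor \<open>T\<close>.\<close>

definition endo_action :: "('v \<Rightarrow> 'v \<Rightarrow> 'v \<Rightarrow> 'v) \<Rightarrow> 'v tensor4 \<Rightarrow> 'v tensor6" where
  "endo_action \<B> T X1 X2 X3 X4 X Y =
     - T (\<B> X Y X1) X2 X3 X4 - T X1 (\<B> X Y X2) X3 X4
     - T X1 X2 (\<B> X Y X3) X4 - T X1 X2 X3 (\<B> X Y X4)"

definition curvature_dot :: "'v tensor2 \<Rightarrow> 'v tensor4 \<Rightarrow> 'v tensor4 \<Rightarrow> 'v tensor6" where
  "curvature_dot h B T = endo_action (curvature_endo h B) T"

definition tachibana :: "('v::real_vector) tensor2 \<Rightarrow> 'v tensor4 \<Rightarrow> 'v tensor6" where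
  "tachibana A T = endo_action (wedge_endo A) T"


section \<open>Affine curvature and quasi-umbilicity\<close>

definition opozda_verstraelen ::
  "('n affine_space \<Rightarrow> 'n affine_space) \<Rightarrow> (real^('n::finite) \<Rightarrow> 'n affine_space) \<Rightarrow>
     real^'n \<Rightarrow> (real^'n) tensor4" where
  "opozda_verstraelen \<xi> f u X1 X2 X3 X4 =
     (1/2) * kulkarni_nomizu (shape_form \<xi> f u) (shape_form \<xi> f u) X1 X2 X3 X4"

definition tr_shape ::
  "('n affine_space \<Rightarrow> 'n affine_space) \<Rightarrow> (real^('n::finite) \<Rightarrow> 'n affine_space) \<Rightarrow>
     real^'n \<Rightarrow> real" where
  "tr_shape \<xi> f u = trace (matrix (shape_operator \<xi> f u))"

definition rank_one_at ::
  "('n::finite) affine_space set \<Rightarrow> ('n affine_space \<Rightarrow> 'n affine_space) \<Rightarrow>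
     'n affine_space \<Rightarrow> real \<Rightarrow> bool" where
  "rank_one_at M \<xi> x \<rho> \<longleftrightarrow>
     (\<forall>f u. parametrized_at M x f u \<longrightarrow>
        form_rank (\<lambda>X Y. shape_form \<xi> f u X Y - \<rho> * blaschke_metric \<xi> f u X Y) = 1)"

definition affine_quasi_umbilical_at ::
  "('n::finite) affine_space set \<Rightarrow> ('n affine_space \<Rightarrow> 'n affine_space) \<Rightarrow>
     'n affine_space \<Rightarrow> bool" where
  "affine_quasi_umbilical_at M \<xi> x \<longleftrightarrow>
     (\<forall>f u. parametrized_at M x f u \<longrightarrow> \<not> (\<exists>c. \<forall>X. shape_operator \<xi> f u X = c *\<^sub>R X)) \<and>
     (\<exists>\<rho>. rank_one_at M \<xi> x \<rho>)"

end

theory Submission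
  imports Defs
begin

text \<open>
  The shape operator \<open>\<S>\<close> is \<open>h\<close>-self-adjoint, so rank one of \<open>S - \<rho> h\<close> means
  \<open>\<S> = \<rho> I + k h(\<cdot>, w) w\<close>.  Hence \<open>\<S>\<^sup>2 = \<beta> \<S> - L I\<close> with \<open>\<beta> = tr \<S> - (n - 2) \<rho>\<close>.
  The curvature endomorphism of \<open>R\<^sup>*\<close> is \<open>S(Y,Z) \<S>X - S(X,Z) \<S>Y\<close>; acting as a derivation on \<open>S\<close>
  it produces only terms in \<open>h(\<S>X, \<S>Y) = \<beta> S(X,Y) - L h(X,Y)\<close>, of which the \<open>\<beta>\<close> part cancels
  and the rest is \<open>L Q(h,S)\<close>.  Contracting, the Ricci tensor is \<open>tr \<S> S - h(\<S>\<cdot>, \<S>\<cdot>)\<close>, and its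
  difference from \<open>\<rho> (tr \<S> - \<rho>) h\<close> is \<open>(n - 2) \<rho> (S - \<rho> h)\<close>.

  Self-adjointness, like the symmetry of \<open>h\<close>, is the symmetry of a second derivative: if the
  covector \<open>a\<close> annihilates the tangent space at \<open>u\<close> and \<open>a(\<xi>) = 1\<close>, then \<open>h(X,Y) = a(D\<^sup>2f(X,Y))\<close> and
  \<open>h(X, \<S>Y) = - a(D\<^sup>2\<xi>(X,Y))\<close>.
\<close>

section \<open>Symmetry of second derivatives\<close>

text \<open>The mean value theorem applies twice: first along \<open>X\<close> to the difference of
  \<open>g\<close> over the step \<open>t *\<^sub>R Y\<close>, then along \<open>Y\<close> to the
  resulting difference of \<open>g' _ X\<close>.\<close>

lemma second_difference_mvt:
  fixes g :: "'a::real_normed_vector \<Rightarrow> real"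
  assumes g: "\<And>v. v \<in> U \<Longrightarrow> (g has_derivative g' v) (at v)"
    and gX: "\<And>v. v \<in> U \<Longrightarrow> ((\<lambda>v. g' v X) has_derivative gX' v) (at v)"
    and t: "t > 0"
    and U: "\<And>a b. a \<in> {0..t} \<Longrightarrow> b \<in> {0..t} \<Longrightarrow> u + a *\<^sub>R X + b *\<^sub>R Y \<in> U"
  shows "\<exists>a\<in>{0..t}. \<exists>b\<in>{0..t}.
    g (u + t *\<^sub>R X + t *\<^sub>R Y) - g (u + t *\<^sub>R X) - g (u + t *\<^sub>R Y) + g u
      = t\<^sup>2 * gX' (u + a *\<^sub>R X + b *\<^sub>R Y) Y"
proof -
  \<comment> \<open>The term \<open>0 *\<^sub>R Y\<close> is kept so that both summands are
    instances of \<open>d\<close>, with \<open>b = t\<close> and \<open>b = 0\<close>.\<close>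
  define \<psi> where "\<psi> s = g (u + s *\<^sub>R X + t *\<^sub>R Y) - g (u + s *\<^sub>R X + 0 *\<^sub>R Y)" for s
  have lin: "g' v (s *\<^sub>R X) = s * g' v X" if "v \<in> U" for v s
    using has_derivative_bounded_linear[OF g[OF that], THEN bounded_linear.linear]
    by (simp add: linear_cmul)
  have linX: "gX' v (s *\<^sub>R Y) = s * gX' v Y" if "v \<in> U" for v s
    using has_derivative_bounded_linear[OF gX[OF that], THEN bounded_linear.linear]
    by (simp add: linear_cmul)
  have d: "((\<lambda>s. g (u + s *\<^sub>R X + b *\<^sub>R Y)) has_derivative
      (\<lambda>r. r * g' (u + s *\<^sub>R X + b *\<^sub>R Y) X)) (at s)"
    if "s \<in> {0..t}" "b \<in> {0..t}" for s b
  proof -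
    have "((\<lambda>s. u + s *\<^sub>R X + b *\<^sub>R Y) has_derivative (\<lambda>r. r *\<^sub>R X)) (at s)"
      by (auto intro!: derivative_eq_intros)
    from has_derivative_compose[OF this, where g = g and g' = "g' (u + s *\<^sub>R X + b *\<^sub>R Y)"]
    show ?thesis using g[OF U[OF that]] by (simp add: lin[OF U[OF that]])
  qed
  have dX: "((\<lambda>b. g' (u + s *\<^sub>R X + b *\<^sub>R Y) X) has_derivative
      (\<lambda>r. r * gX' (u + s *\<^sub>R X + b *\<^sub>R Y) Y)) (at b)"
    if "s \<in> {0..t}" "b \<in> {0..t}" for s b
  proof -
    have "((\<lambda>b. u + s *\<^sub>R X + b *\<^sub>R Y) has_derivative (\<lambda>r. r *\<^sub>R Y)) (at b)"
      by (auto intro!: derivative_eq_intros)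
    from has_derivative_compose[OF this, where g = "\<lambda>v. g' v X" and g' = "gX' (u + s *\<^sub>R X + b *\<^sub>R Y)"]
    show ?thesis using gX[OF U[OF that]] by (simp add: linX[OF U[OF that]])
  qed
  have "\<exists>s\<in>{0<..<t}. \<psi> t - \<psi> 0 =
      (t - 0) * g' (u + s *\<^sub>R X + t *\<^sub>R Y) X - (t - 0) * g' (u + s *\<^sub>R X + 0 *\<^sub>R Y) X"
    unfolding \<psi>_def
    by (rule mvt_simple[OF t, where f' = "\<lambda>s r. r * g' (u + s *\<^sub>R X + t *\<^sub>R Y) X
          - r * g' (u + s *\<^sub>R X + 0 *\<^sub>R Y) X"])
      (use t in \<open>intro has_derivative_diff has_derivative_at_withinI[OF d]; simp\<close>)
  then obtain s where s: "s \<in> {0<..<t}" and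
    ps: "\<psi> t - \<psi> 0 = t * (g' (u + s *\<^sub>R X + t *\<^sub>R Y) X - g' (u + s *\<^sub>R X + 0 *\<^sub>R Y) X)"
    by (auto simp: right_diff_distrib)
  have "\<exists>b\<in>{0<..<t}. g' (u + s *\<^sub>R X + t *\<^sub>R Y) X - g' (u + s *\<^sub>R X + 0 *\<^sub>R Y) X =
      (t - 0) * gX' (u + s *\<^sub>R X + b *\<^sub>R Y) Y"
    by (rule mvt_simple[OF t, where f' = "\<lambda>b r. r * gX' (u + s *\<^sub>R X + b *\<^sub>R Y) Y"])
      (use t s in \<open>intro has_derivative_at_withinI[OF dX]; simp\<close>)
  then obtain b where "b \<in> {0<..<t}"
    "g' (u + s *\<^sub>R X + t *\<^sub>R Y) X - g' (u + s *\<^sub>R X + 0 *\<^sub>R Y) X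
      = t * gX' (u + s *\<^sub>R X + b *\<^sub>R Y) Y"
    by auto
  with ps s show ?thesis
    by (intro bexI[of _ s] bexI[of _ b]) (auto simp: \<psi>_def power2_eq_square algebra_simps)
qed

text \<open>The second difference over the parallelogram spanned by \<open>t *\<^sub>R X\<close> and
  \<open>t *\<^sub>R Y\<close> is symmetric in \<open>X\<close> and \<open>Y\<close>. Divided by
  \<open>t\<^sup>2\<close> it is a value of either mixed derivative near \<open>u\<close>, so
  continuity at \<open>u\<close> forces equality.\<close>

lemma second_derivative_symmetric:
  fixes g :: "'a::real_normed_vector \<Rightarrow> real"
  assumes "open U" "u \<in> U"
    and g: "\<And>v. v \<in> U \<Longrightarrow> (g has_derivative g' v) (at v)"
    and gX: "\<And>v. v \<in> U \<Longrightarrow> ((\<lambda>v. g' v X) has_derivative gX' v) (at v)"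
    and gY: "\<And>v. v \<in> U \<Longrightarrow> ((\<lambda>v. g' v Y) has_derivative gY' v) (at v)"
    and contX: "isCont (\<lambda>v. gX' v Y) u"
    and contY: "isCont (\<lambda>v. gY' v X) u"
  shows "gX' u Y = gY' u X"
proof (rule ccontr)
  assume ne: "gX' u Y \<noteq> gY' u X"
  \<comment> \<open>Half the gap: values within \<open>e\<close> of the two mixed derivatives at
    \<open>u\<close> cannot coincide.\<close>
  define e where "e = \<bar>gX' u Y - gY' u X\<bar> / 2"
  have e: "e > 0" using ne by (simp add: e_def)
  have ev: "\<forall>\<^sub>F v in nhds u. v \<in> U \<and> dist (gX' v Y) (gX' u Y) < e \<and> dist (gY' v X) (gY' u X) < e"
    using eventually_nhds_in_open[OF assms(1,2)]
      tendstoD[OF contX[unfolded isCont_def, THEN tendsto_at_iff_tendsto_nhds[of "\<lambda>v. gX' v Y", THEN iffD1]] e]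
      tendstoD[OF contY[unfolded isCont_def, THEN tendsto_at_iff_tendsto_nhds[of "\<lambda>v. gY' v X", THEN iffD1]] e]
    by eventually_elim simp
  then obtain r where r: "r > 0" and
    near: "\<And>v. dist v u < r \<Longrightarrow> v \<in> U \<and> dist (gX' v Y) (gX' u Y) < e \<and> dist (gY' v X) (gY' u X) < e"
    unfolding eventually_nhds_metric by blast
  \<comment> \<open>This keeps the whole parallelogram inside the ball of radius \<open>r\<close>;
    the summand 1 keeps the denominator positive and the bound strict.\<close>
  define t where "t = r / (norm X + norm Y + 1)"
  have pos: "norm X + norm Y + 1 > 0" by (smt (verit) norm_ge_zero)
  have t: "t > 0" using r pos by (simp add: t_def)
  have small: "dist (u + a *\<^sub>R X + b *\<^sub>R Y) u < r" if "a \<in> {0..t}" "b \<in> {0..t}" for a b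
  proof -
    have "dist (u + a *\<^sub>R X + b *\<^sub>R Y) u = norm (a *\<^sub>R X + b *\<^sub>R Y)" by (simp add: dist_norm)
    also have "\<dots> \<le> a * norm X + b * norm Y" using that norm_triangle_ineq[of "a *\<^sub>R X" "b *\<^sub>R Y"] by simp
    also have "\<dots> \<le> t * norm X + t * norm Y" using that by (intro add_mono mult_right_mono) auto
    also have "\<dots> < t * (norm X + norm Y + 1)" using t by (simp add: algebra_simps)
    also have "\<dots> = r" using pos by (simp add: t_def)
    finally show ?thesis .
  qed
  have "\<exists>a\<in>{0..t}. \<exists>b\<in>{0..t}. g (u + t *\<^sub>R X + t *\<^sub>R Y) - g (u + t *\<^sub>R X) - g (u + t *\<^sub>R Y) + g u
      = t\<^sup>2 * gX' (u + a *\<^sub>R X + b *\<^sub>R Y) Y"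
    by (rule second_difference_mvt[OF g gX t]) (auto simp: near small)
  then obtain a b where ab: "a \<in> {0..t}" "b \<in> {0..t}"
    and 1: "g (u + t *\<^sub>R X + t *\<^sub>R Y) - g (u + t *\<^sub>R X) - g (u + t *\<^sub>R Y) + g u
      = t\<^sup>2 * gX' (u + a *\<^sub>R X + b *\<^sub>R Y) Y" by blast
  have small': "dist (u + a *\<^sub>R Y + b *\<^sub>R X) u < r" if "a \<in> {0..t}" "b \<in> {0..t}" for a b
    using small[OF that(2,1)] by (simp add: algebra_simps)
  have "\<exists>c\<in>{0..t}. \<exists>d\<in>{0..t}. g (u + t *\<^sub>R Y + t *\<^sub>R X) - g (u + t *\<^sub>R Y) - g (u + t *\<^sub>R X) + g u
      = t\<^sup>2 * gY' (u + c *\<^sub>R Y + d *\<^sub>R X) X"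
    by (rule second_difference_mvt[OF g gY t]) (auto simp: near small')
  then obtain c d where cd: "c \<in> {0..t}" "d \<in> {0..t}"
    and 2: "g (u + t *\<^sub>R Y + t *\<^sub>R X) - g (u + t *\<^sub>R Y) - g (u + t *\<^sub>R X) + g u
      = t\<^sup>2 * gY' (u + c *\<^sub>R Y + d *\<^sub>R X) X" by blast
  have "t\<^sup>2 * gX' (u + a *\<^sub>R X + b *\<^sub>R Y) Y = t\<^sup>2 * gY' (u + c *\<^sub>R Y + d *\<^sub>R X) X"
    using 1 2 add.commute[of "t *\<^sub>R X" "t *\<^sub>R Y"] by (simp only: add.assoc)
  then have "gX' (u + a *\<^sub>R X + b *\<^sub>R Y) Y = gY' (u + c *\<^sub>R Y + d *\<^sub>R X) X"
    using t by simp
  moreover have "\<bar>gX' (u + a *\<^sub>R X + b *\<^sub>R Y) Y - gX' u Y\<bar> < e"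
    using near[OF small[OF ab]] by (simp add: dist_real_def)
  moreover have "\<bar>gY' (u + c *\<^sub>R Y + d *\<^sub>R X) X - gY' u X\<bar> < e"
    using near[OF small'[OF cd]] by (simp add: dist_real_def)
  ultimately show False
    unfolding e_def by (auto simp: abs_if split: if_splits)
qed

section \<open>Directional derivatives of smooth maps\<close>

lemma smooth_on_differentiable:
  assumes "smooth_on f U" "open U" "u \<in> U"
  shows "(f has_derivative dir_deriv f u) (at u)"
proof -
  have "Ck_on (Suc 0) f U" using assms(1) unfolding smooth_on_def by blast
  then have "f differentiable_on U" by simp
  then have "f differentiable (at u)"
    using assms(2,3) by (metis differentiable_on_def at_within_open)
  then show ?thesis by (rule iffD1[OF frechet_derivative_works])
qed

lemma smooth_on_dir_deriv: "smooth_on f U \<Longrightarrow> smooth_on (\<lambda>u. dir_deriv f u X) U"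
  unfolding smooth_on_def
proof
  fix k
  assume "\<forall>k. Ck_on k f U"
  from this[rule_format, of "Suc k"] show "Ck_on k (\<lambda>u. dir_deriv f u X) U"
    by simp
qed

lemma smooth_on_isCont: "smooth_on f U \<Longrightarrow> open U \<Longrightarrow> u \<in> U \<Longrightarrow> isCont f u"
  by (rule has_derivative_continuous[OF smooth_on_differentiable])

text \<open>Pairing with a basis vector \<open>b\<close> reduces the claim to real functions;
  smoothness supplies the derivatives and their continuity.\<close>

lemma dir_deriv_commute:
  fixes f :: "'a::real_normed_vector \<Rightarrow> 'b::euclidean_space"
  assumes f: "smooth_on f U" and U: "open U" "u \<in> U"
  shows "dir_deriv (\<lambda>v. dir_deriv f v X) u Y = dir_deriv (\<lambda>v. dir_deriv f v Y) u X"
proof (rule euclidean_eqI)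
  fix b :: 'b
  define g where "g = (\<lambda>v. f v \<bullet> b)"
  define g' where "g' = (\<lambda>v Z. dir_deriv f v Z \<bullet> b)"
  define g'' where "g'' = (\<lambda>Z v W. dir_deriv (\<lambda>v. dir_deriv f v Z) v W \<bullet> b)"
  have d1: "(g has_derivative g' v) (at v)" if "v \<in> U" for v
    unfolding g_def g'_def
    by (rule has_derivative_inner_left[OF smooth_on_differentiable[OF f U(1) that]])
  have d2: "((\<lambda>v. g' v Z) has_derivative g'' Z v) (at v)" if "v \<in> U" for v Z
    unfolding g''_def g'_def
    by (rule has_derivative_inner_left[OF smooth_on_differentiable[OF smooth_on_dir_deriv[OF f] U(1) that]])
  have c: "isCont (\<lambda>v. g'' Z v W) u" for Z W
    unfolding g''_def
    by (rule continuous_inner[OF smooth_on_isCont[OF smooth_on_dir_deriv[OF smooth_on_dir_deriv[OF f]] U]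
        continuous_const])
  have "g'' X u Y = g'' Y u X"
    by (rule second_derivative_symmetric[OF U d1 d2 d2 c c])
  then show "dir_deriv (\<lambda>v. dir_deriv f v X) u Y \<bullet> b = dir_deriv (\<lambda>v. dir_deriv f v Y) u X \<bullet> b"
    by (simp add: g''_def)
qed

section \<open>Scalar products and quasi-umbilical shape operators\<close>

lemma bilinear_form_matrix:
  fixes T :: "(real^'n::finite) tensor2"
  assumes "bilinear T"
  shows "T X Y = X \<bullet> ((\<chi> i j. T (axis i 1) (axis j 1) :: real^'n^'n) *v Y)"
proof -
  let ?B = "\<chi> i j. T (axis i 1) (axis j 1) :: real^'n^'n"
  have "bilinear (\<lambda>X Y. X \<bullet> (?B *v Y))"
    unfolding bilinear_def linear_iff
    by (simp add: inner_add inner_right_distrib matrix_vector_right_distrib matrix_vector_mult_scaleR)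
  moreover have "T i j = i \<bullet> (?B *v j)" if "i \<in> Basis" "j \<in> Basis" for i j
    using that by (auto simp: Basis_vec_def inner_axis' matrix_vector_mult_basis column_def)
  ultimately have "T = (\<lambda>X Y. X \<bullet> (?B *v Y))"
    using bilinear_eq_stdbasis[OF assms] by blast
  then show ?thesis by (rule fun_cong[THEN fun_cong])
qed

text \<open>The range of the matrix is a line spanned by some \<open>b\<close>, so
  \<open>T X Y\<close> splits as \<open>g Y * (X \<bullet> b)\<close> and its two-by-two minors
  vanish.\<close>

lemma form_rank_one_minors:
  fixes T :: "(real^'n::finite) tensor2"
  assumes "bilinear T" "form_rank T = 1"
  shows "T X Y * T Z W = T X W * T Z Y"
proof -
  let ?B = "\<chi> i j. T (axis i 1) (axis j 1) :: real^'n^'n"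
  have dim: "dim (range (\<lambda>x. ?B *v x)) = 1"
    using assms(2) unfolding form_rank_def rank_dim_range by simp
  obtain C where C: "range (\<lambda>x. ?B *v x) \<subseteq> span C" "card C = dim (range (\<lambda>x. ?B *v x))"
    using basis_exists by metis
  then obtain b where "C = {b}" using dim by (metis card_1_singletonE)
  then have "\<exists>c. ?B *v Y = c *\<^sub>R b" for Y
    using C(1) by (auto simp: span_singleton)
  then obtain g where g: "\<And>Y. ?B *v Y = g Y *\<^sub>R b" by metis
  have "T X Y = g Y * (X \<bullet> b)" for X Y
    using bilinear_form_matrix[OF assms(1), of X Y] g by simp
  then show ?thesis by simp
qed

lemma form_rank_zero: "form_rank (\<lambda>X Y. 0) = 0"
  by (simp add: form_rank_def rank_eq_0 vec_eq_iff)

lemma form_rank_scale: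
  assumes "c \<noteq> 0"
  shows "form_rank (\<lambda>X Y. c * T X Y) = form_rank T"
proof -
  let ?B = "\<chi> i j. T (axis i 1) (axis j 1) :: real^_^_"
  have "(\<chi> i j. c * T (axis i 1) (axis j 1)) = c *\<^sub>R ?B"
    by (simp add: vec_eq_iff)
  moreover have "range (\<lambda>x. (c *\<^sub>R ?B) *v x) = range (\<lambda>x. ?B *v x)"
  proof -
    have "(c *\<^sub>R ?B) *v x = ?B *v (c *\<^sub>R x)" for x
      by (simp add: scaleR_matrix_vector_assoc matrix_vector_mult_scaleR)
    moreover have "?B *v x = (c *\<^sub>R ?B) *v ((1/c) *\<^sub>R x)" for x
      using assms by (simp flip: scaleR_matrix_vector_assoc add: matrix_vector_mult_scaleR)
    ultimately show ?thesis by blast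
  qed
  ultimately show ?thesis by (simp add: form_rank_def rank_dim_range)
qed

text \<open>The rank-one map has trace \<open>l w\<close>, as seen by expanding \<open>w\<close> in
  the standard basis.\<close>

lemma trace_matrix_scalar_plus_rank_one:
  fixes l :: "real^'n::finite \<Rightarrow> real" and w :: "real^'n"
  assumes "linear l"
  shows "trace (matrix (\<lambda>X. r *\<^sub>R X + l X *\<^sub>R w)) = real CARD('n) * r + l w"
proof -
  have "l w = l (\<Sum>i\<in>UNIV. w $ i *\<^sub>R axis i 1)"
    using basis_expansion[of w] by (simp add: scalar_mult_eq_scaleR)
  also have "\<dots> = (\<Sum>i\<in>UNIV. w $ i * l (axis i 1))"
    by (simp add: linear_sum[OF assms] linear_cmul[OF assms])
  finally show ?thesis
    by (simp add: trace_def matrix_def sum.distrib mult.commute)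
qed

section \<open>Non-degenerate symmetric forms and their orthonormal bases\<close>

locale scalar_product =
  fixes h :: "(real^'n::finite) tensor2"
  assumes bilinear: "bilinear h"
    and sym: "h X Y = h Y X"
    and nondegenerate: "nondegenerate_form h"
begin

lemma add_left: "h (X + Y) Z = h X Z + h Y Z" by (rule bilinear_ladd[OF bilinear])
lemma add_right: "h X (Y + Z) = h X Y + h X Z" by (rule bilinear_radd[OF bilinear])
lemma diff_left: "h (X - Y) Z = h X Z - h Y Z" by (rule bilinear_lsub[OF bilinear])
lemma diff_right: "h X (Y - Z) = h X Y - h X Z" by (rule bilinear_rsub[OF bilinear])
lemma scale_left: "h (c *\<^sub>R X) Z = c * h X Z" using bilinear_lmul[OF bilinear] by simp
lemma scale_right: "h X (c *\<^sub>R Z) = c * h X Z" using bilinear_rmul[OF bilinear] by simp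
lemma zero_left: "h 0 Z = 0" by (rule bilinear_lzero[OF bilinear])
lemma zero_right: "h X 0 = 0" by (rule bilinear_rzero[OF bilinear])
lemma linear_right: "linear (h X)" using bilinear by (simp add: bilinear_def)
lemma sum_left: "h (\<Sum>i\<in>I. f i) Z = (\<Sum>i\<in>I. h (f i) Z)"
  by (induction I rule: infinite_finite_induct) (auto simp: add_left zero_left)

lemmas form_simps = add_left add_right diff_left diff_right scale_left scale_right zero_left zero_right sum_left

lemma eqI: "(\<And>Z. h X Z = h Y Z) \<Longrightarrow> X = Y"
  using nondegenerate[unfolded nondegenerate_form_def, rule_format, of "X - Y"] by (simp add: diff_left)

lemma subspace_orthogonal: "subspace {Y. h X Y = 0}"
  by (simp add: subspace_def form_simps)

definition orthonormal_set :: "(real^'n) set \<Rightarrow> bool" where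
  "orthonormal_set E \<longleftrightarrow> (\<forall>x\<in>E. h x x = 1 \<or> h x x = -1) \<and> (\<forall>x\<in>E. \<forall>y\<in>E. x \<noteq> y \<longrightarrow> h x y = 0)"

text \<open>A vector in the span of the others would be orthogonal to itself, against
  \<open>h x x\<close> being 1 or -1.\<close>

lemma orthonormal_set_independent:
  assumes "orthonormal_set E"
  shows "independent E"
proof
  assume "dependent E"
  then obtain x where x: "x \<in> E" "x \<in> span (E - {x})" by (auto simp: dependent_def)
  have "E - {x} \<subseteq> {y. h x y = 0}"
    using assms x(1) by (auto simp: orthonormal_set_def)
  then have "span (E - {x}) \<subseteq> {y. h x y = 0}"
    by (rule span_minimal[OF _ subspace_orthogonal])
  then have "h x x = 0" using x(2) by auto
  then show False using assms x(1) by (auto simp: orthonormal_set_def)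
qed

text \<open>Gram-Schmidt for an indefinite form: the orthogonal complement of \<open>E\<close> may
  contain null vectors, so a non-null one has to be found before normalizing.\<close>

lemma orthonormal_set_extend:
  assumes E: "orthonormal_set E" and card: "card E < CARD('n)"
  obtains q where "q \<notin> E" "orthonormal_set (insert q E)"
proof -
  have fin: "finite E" and ind: "independent E"
    using orthonormal_set_independent[OF E] independent_imp_finite by auto
  \<comment> \<open>Projection to the complement of \<open>E\<close>; the sign \<open>h e e\<close>
    is its own inverse and so replaces the usual division.\<close>
  define p where "p z = z - (\<Sum>e\<in>E. (h e e * h z e) *\<^sub>R e)" for z
  have p_orth: "h (p z) e = 0" if "e \<in> E" for z e
  proof -
    have "(\<Sum>d\<in>E. h d d * h z d * h d e) = (\<Sum>d\<in>E. if d = e then h e e * h z e * h e e else 0)"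
      using E that by (intro sum.cong) (auto simp: orthonormal_set_def)
    also have "\<dots> = h e e * h z e * h e e" using fin that by simp
    also have "\<dots> = h z e" using E that by (auto simp: orthonormal_set_def)
    finally show ?thesis by (simp add: p_def form_simps)
  qed
  have "dim (span E) < DIM(real^'n)"
    using ind card by (simp add: dim_eq_card_independent)
  then have "span E \<noteq> UNIV" using dim_UNIV by (metis less_irrefl)
  then obtain x where x: "x \<notin> span E" by auto
  have "(\<Sum>e\<in>E. (h e e * h x e) *\<^sub>R e) \<in> span E"
    by (intro span_sum span_scale span_base)
  with x have "p x \<noteq> 0" by (auto simp: p_def)
  then obtain z where z: "h (p x) z \<noteq> 0"
    using nondegenerate by (auto simp: nondegenerate_form_def)
  have "h e (p x) = 0" if "e \<in> E" for e
    using p_orth[OF that] sym by metis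
  then have "h (\<Sum>e\<in>E. (h e e * h z e) *\<^sub>R e) (p x) = 0"
    by (simp add: form_simps)
  \<comment> \<open>\<open>z\<close> and \<open>p z\<close> differ by an element of the span of
    \<open>E\<close>, to which \<open>p x\<close> is orthogonal.\<close>
  then have pp: "h (p x) (p z) \<noteq> 0"
    using z by (simp add: p_def[of z] diff_right sym[of "p x" "sum _ _"])
  have "\<exists>y. h y y \<noteq> 0 \<and> (\<forall>e\<in>E. h y e = 0)"
  proof (rule ccontr)
    assume "\<not> ?thesis"
    then have *: "\<And>y. (\<forall>e\<in>E. h y e = 0) \<Longrightarrow> h y y = 0" by blast
    \<comment> \<open>Polarization: if \<open>p x\<close>, \<open>p z\<close> and their sum were all
      null, \<open>h (p x) (p z)\<close> would vanish.\<close>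
    have "h (p x + p z) (p x + p z) = 0" "h (p x) (p x) = 0" "h (p z) (p z) = 0"
      by (intro *; simp add: form_simps p_orth)+
    then show False using pp by (simp add: form_simps sym[of "p z" "p x"])
  qed
  then obtain y where y: "h y y \<noteq> 0" "\<And>e. e \<in> E \<Longrightarrow> h y e = 0" by blast
  define q where "q = (1 / sqrt \<bar>h y y\<bar>) *\<^sub>R y"
  have "h q q = h y y / \<bar>h y y\<bar>"
    using y(1) by (simp add: q_def form_simps)
  then have q: "h q q = 1 \<or> h q q = -1" using y(1) by (auto simp: abs_if)
  have qE: "h q e = 0" "h e q = 0" if "e \<in> E" for e
    using y(2)[OF that] by (simp_all add: q_def form_simps sym[of e])
  have "q \<notin> E" using q qE by fastforce
  moreover have "orthonormal_set (insert q E)"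
    using E q qE by (auto simp: orthonormal_set_def)
  ultimately show thesis by (rule that)
qed

text \<open>Independence bounds the size of orthonormal sets, so a largest one exists; by the
  extension lemma it has \<open>CARD('n)\<close> elements.\<close>

lemma orthonormal_basis_exists: "\<exists>e. orthonormal_basis h e"
proof -
  have bound: "finite E \<and> card E \<le> CARD('n)" if "orthonormal_set E" for E
    using independent_bound[OF orthonormal_set_independent[OF that]] by simp
  have "orthonormal_set {}" by (simp add: orthonormal_set_def)
  moreover have "\<forall>E. orthonormal_set E \<longrightarrow> card E < Suc CARD('n)" using bound by (simp add: less_Suc_eq_le)
  ultimately have "\<exists>E. orthonormal_set E \<and> (\<forall>F. orthonormal_set F \<longrightarrow> card F \<le> card E)"
    by (rule ex_has_greatest_nat)
  then obtain E where E: "orthonormal_set E" and max: "\<And>F. orthonormal_set F \<Longrightarrow> card F \<le> card E"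
    by blast
  have "card E = CARD('n)"
  proof (rule ccontr)
    assume "card E \<noteq> CARD('n)"
    then have "card E < CARD('n)" using bound[OF E] by simp
    then obtain q where q: "q \<notin> E" "orthonormal_set (insert q E)"
      using orthonormal_set_extend[OF E] by blast
    then show False using max[OF q(2)] bound[OF E] by simp
  qed
  then obtain e where "bij_betw e (UNIV :: 'n set) E"
    using finite_same_card_bij[of "UNIV :: 'n set" E] bound[OF E] by auto
  then have "range e = E" "inj e" by (auto simp: bij_betw_def)
  then have "orthonormal_basis h e"
    using E unfolding orthonormal_basis_def orthonormal_set_def by (metis injD rangeI)
  then show ?thesis by blast
qed

text \<open>The difference \<open>D\<close> of the two sides is orthogonal to every
  \<open>e i\<close>, and these span the space, so non-degeneracy gives
  \<open>D = 0\<close>.\<close>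

lemma orthonormal_basis_expansion:
  assumes e: "orthonormal_basis h e"
  shows "X = (\<Sum>j\<in>UNIV. (h (e j) (e j) * h X (e j)) *\<^sub>R e j)"
proof -
  \<comment> \<open>Injectivity makes \<open>range e\<close> have \<open>CARD('n)\<close> elements,
    so that independence implies spanning.\<close>
  have inj: "inj e"
    using e unfolding orthonormal_basis_def inj_def by (metis zero_neq_one neg_equal_0_iff_equal)
  have "orthonormal_set (range e)"
    using e unfolding orthonormal_set_def orthonormal_basis_def by (metis rangeE)
  then have "independent (range e)" by (rule orthonormal_set_independent)
  then have span: "UNIV \<subseteq> span (range e)"
    by (intro card_ge_dim_independent) (auto simp: card_image[OF inj])
  define D where "D = X - (\<Sum>j\<in>UNIV. (h (e j) (e j) * h X (e j)) *\<^sub>R e j)"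
  have "h D (e i) = 0" for i
  proof -
    have "(\<Sum>j\<in>UNIV. h (e j) (e j) * h X (e j) * h (e j) (e i))
      = (\<Sum>j\<in>UNIV. if j = i then h (e i) (e i) * h X (e i) * h (e i) (e i) else 0)"
      using e by (intro sum.cong) (auto simp: orthonormal_basis_def)
    also have "\<dots> = h (e i) (e i) * h X (e i) * h (e i) (e i)" by simp
    also have "\<dots> = h X (e i)" using e unfolding orthonormal_basis_def
      by (metis mult.right_neutral mult_minus1_right mult_minus_left mult.commute minus_minus)
    finally show ?thesis by (simp add: D_def form_simps)
  qed
  then have "range e \<subseteq> {Y. h D Y = 0}" by auto
  then have "span (range e) \<subseteq> {Y. h D Y = 0}"
    by (rule span_minimal[OF _ subspace_orthogonal])
  then have "D = 0" using span by (intro eqI) (auto simp: zero_left)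
  then show ?thesis by (simp add: D_def)
qed

text \<open>The basis inside \<open>ricci\<close> comes from \<open>SOME\<close>. Since an
  orthonormal basis exists, a value computed for all of them holds for the chosen one.\<close>

lemma ricci_eq_sum:
  assumes "\<And>e. orthonormal_basis h e \<Longrightarrow> (\<Sum>j\<in>UNIV. h (e j) (e j) * B (e j) X Y (e j)) = r"
  shows "ricci h B X Y = r"
  unfolding ricci_def Let_def using someI_ex[OF orthonormal_basis_exists] by (rule assms)

end

section \<open>Curvature built from a self-adjoint operator\<close>

locale shape_space = scalar_product h for h :: "(real^'n::finite) tensor2" +
  fixes A :: "real^'n \<Rightarrow> real^'n"
  assumes linear_A: "linear A"
    and self_adjoint: "h X (A Y) = h (A X) Y"
begin

definition S :: "(real^'n) tensor2" where "S X Y = h X (A Y)"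

definition R :: "(real^'n) tensor4" where
  "R X1 X2 X3 X4 = (1/2) * kulkarni_nomizu S S X1 X2 X3 X4"

lemma S_sym: "S X Y = S Y X"
  unfolding S_def using self_adjoint sym by metis

lemma S_linear:
  "S (X + Y) Z = S X Z + S Y Z" "S (X - Y) Z = S X Z - S Y Z" "S (c *\<^sub>R X) Z = c * S X Z"
  by (simp_all add: S_def form_simps)

lemma S_linear_right:
  "S Z (X + Y) = S Z X + S Z Y" "S Z (X - Y) = S Z X - S Z Y" "S Z (c *\<^sub>R X) = c * S Z X"
  using S_linear S_sym[of Z] by simp_all

lemma R_eq: "R X1 X2 X3 X4 = S X1 X4 * S X2 X3 - S X1 X3 * S X2 X4"
  by (simp add: R_def kulkarni_nomizu_def)

text \<open>Self-adjointness shows that this vector represents \<open>R X Y Z\<close>;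
  non-degeneracy gives the uniqueness that \<open>THE\<close> requires.\<close>

lemma curvature_endo_R: "curvature_endo h R X Y Z = S Y Z *\<^sub>R A X - S X Z *\<^sub>R A Y"
  unfolding curvature_endo_def
proof (rule the_equality)
  have *: "h (S Y Z *\<^sub>R A X - S X Z *\<^sub>R A Y) V = R X Y Z V" for V
    by (simp add: R_eq form_simps S_def self_adjoint)
  then show "\<forall>V. h (S Y Z *\<^sub>R A X - S X Z *\<^sub>R A Y) V = R X Y Z V" ..
  show "W = S Y Z *\<^sub>R A X - S X Z *\<^sub>R A Y" if "\<forall>V. h W V = R X Y Z V" for W
    by (rule eqI) (simp add: that *)
qed

end

section \<open>Quasi-umbilical operators\<close>

locale quasi_umbilical_space = shape_space h A
  for h :: "(real^'n::finite) tensor2" and A +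
  fixes \<rho> :: real
  assumes rank_one: "form_rank (\<lambda>X Y. S X Y - \<rho> * h X Y) = 1"
begin

definition tr :: real where "tr = trace (matrix A)"

text \<open>For \<open>T\<close> of rank one and \<open>T Z Z \<noteq> 0\<close>, vanishing minors
  give \<open>T X Y = T X Z * T Y Z / T Z Z\<close>; raising an index with \<open>h\<close> yields
  the formula with \<open>k = 1 / T Z Z\<close>.\<close>

lemma A_eq_scalar_plus_rank_one:
  obtains k w where "\<And>Y. A Y = \<rho> *\<^sub>R Y + (k * h Y w) *\<^sub>R w"
    and "tr = real CARD('n) * \<rho> + k * h w w"
proof -
  define T where "T X Y = S X Y - \<rho> * h X Y" for X Y
  have T_sym: "T X Y = T Y X" for X Y unfolding T_def using S_sym sym by metis
  have "bilinear T"
    unfolding bilinear_def linear_iff T_def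
    by (simp add: S_linear S_linear_right form_simps algebra_simps)
  moreover have rank: "form_rank T = 1"
    using rank_one by (simp add: T_def[abs_def])
  ultimately have minors: "T X Y * T Z W = T X W * T Z Y" for X Y Z W
    by (rule form_rank_one_minors)
  \<comment> \<open>If the diagonal vanished, the minor \<open>T X Y * T Y X = T X X * T Y Y\<close>
    and symmetry would give \<open>T = 0\<close>.\<close>
  obtain Z where Z: "T Z Z \<noteq> 0"
  proof (rule ccontr)
    assume "\<not> thesis"
    then have "T X X = 0" for X using that by blast
    then have "T X Y * T X Y = 0" for X Y
      using minors[of X Y Y X] T_sym[of Y X] by simp
    then have "T = (\<lambda>X Y. 0)" by (intro ext) simp
    then have "form_rank T = 0" by (simp only: form_rank_zero)
    then show False using rank by simp
  qed
  \<comment> \<open>This is the vector representing \<open>T _ Z\<close> through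
    \<open>h\<close>.\<close>
  define w where "w = A Z - \<rho> *\<^sub>R Z"
  have hw: "h X w = T X Z" for X by (simp add: w_def T_def S_def form_simps)
  have A: "A Y = \<rho> *\<^sub>R Y + (1 / T Z Z * h Y w) *\<^sub>R w" for Y
  proof (rule eqI)
    fix X
    have "T X Y = T X Z * T Y Z / T Z Z"
      using minors[of X Y Z Z] Z T_sym[of Y Z] by (simp add: field_simps)
    then have "S X Y = \<rho> * h X Y + T X Z * T Y Z / T Z Z" by (simp add: T_def)
    moreover have "h (A Y) X = S X Y" by (simp add: S_def sym)
    moreover have "h w X = T X Z" using hw sym by metis
    ultimately show "h (A Y) X = h (\<rho> *\<^sub>R Y + (1 / T Z Z * h Y w) *\<^sub>R w) X"
      by (simp add: form_simps hw sym[of Y X])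
  qed
  have "linear (\<lambda>Y. 1 / T Z Z * h Y w)"
    by (simp add: linear_iff form_simps add_divide_distrib)
  note trace = trace_matrix_scalar_plus_rank_one[OF this, of \<rho> w]
  have "A = (\<lambda>Y. \<rho> *\<^sub>R Y + (1 / T Z Z * h Y w) *\<^sub>R w)"
    by (rule ext) (rule A)
  then have "tr = real CARD('n) * \<rho> + 1 / T Z Z * h w w"
    by (subst tr_def) (simp only: trace)
  with A show thesis by (rule that)
qed

definition L :: real where "L = \<rho> * (tr - (real CARD('n) - 1) * \<rho>)"

text \<open>The minimal polynomial of the shape operator has degree two; its constant term is \<open>L\<close>.\<close>

lemma S_square: "S X (A Y) = (tr - (real CARD('n) - 2) * \<rho>) * S X Y - L * h X Y"
proof -
  obtain k w where A: "\<And>Y. A Y = \<rho> *\<^sub>R Y + (k * h Y w) *\<^sub>R w"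
    and tr: "tr = real CARD('n) * \<rho> + k * h w w"
    using A_eq_scalar_plus_rank_one by metis
  show ?thesis
    \<comment> \<open>Squaring the rank-one part multiplies it by \<open>k * h w w\<close>, which is
      \<open>tr - real CARD('n) * \<rho>\<close>.\<close>
    unfolding S_def L_def tr A form_simps by (simp add: algebra_simps)
qed

text \<open>Links the coordinate trace to the \<open>h\<close>-trace: the scalar part contributes
  \<rho> for each basis vector, and the rank-one part sums to \<open>k * h w w\<close> by expanding
  \<open>w\<close>.\<close>

lemma trace_eq_sum:
  assumes e: "orthonormal_basis h e"
  shows "(\<Sum>j\<in>UNIV. h (e j) (e j) * S (e j) (e j)) = tr"
proof -
  obtain k w where A: "\<And>Y. A Y = \<rho> *\<^sub>R Y + (k * h Y w) *\<^sub>R w"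
    and tr: "tr = real CARD('n) * \<rho> + k * h w w"
    using A_eq_scalar_plus_rank_one by metis
  have "h (e j) (e j) * S (e j) (e j) = \<rho> + k * (h (e j) (e j) * h w (e j) * h (e j) w)" for j
  proof -
    have "h (e j) (e j) * h (e j) (e j) = 1"
      using e[unfolded orthonormal_basis_def, THEN conjunct1, rule_format, of j] by auto
    moreover have "S (e j) (e j) = \<rho> * h (e j) (e j) + k * h (e j) w * h (e j) w"
      by (simp add: S_def A form_simps)
    moreover have "h w (e j) = h (e j) w" by (rule sym)
    ultimately show ?thesis by algebra
  qed
  then have "(\<Sum>j\<in>UNIV. h (e j) (e j) * S (e j) (e j))
      = real CARD('n) * \<rho> + k * h (\<Sum>j\<in>UNIV. (h (e j) (e j) * h w (e j)) *\<^sub>R e j) w"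
    unfolding sum_left scale_left by (simp add: sum.distrib sum_distrib_left)
  then show ?thesis
    by (simp only: orthonormal_basis_expansion[OF e, of w, symmetric] tr)
qed

lemma S_A_left: "S (A X) Y = S X (A Y)"
  by (simp add: S_def self_adjoint)

text \<open>\<open>R\<close> is quadratic in \<open>S\<close>, so by the Leibniz rule
  (\<open>split\<close>) it suffices to compare how both endomorphisms act on \<open>S\<close>
  (\<open>*\<close>).\<close>

lemma curvature_dot_R: "curvature_dot h R R X1 X2 X3 X4 X Y = L * tachibana h R X1 X2 X3 X4 X Y"
proof -
  let ?\<B> = "curvature_endo h R X Y" and ?W = "wedge_endo h X Y"
  have *: "S (?\<B> U) V + S U (?\<B> V) = L * (S (?W U) V + S U (?W V))" for U V
    unfolding curvature_endo_R wedge_endo_def S_linear S_linear_right S_A_left S_square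
    \<comment> \<open>Moving \<open>X\<close> and \<open>Y\<close> to the first slot makes equal
      terms syntactically equal, so that they cancel.\<close>
    unfolding S_sym[of U X] S_sym[of U Y] S_sym[of V X] S_sym[of V Y]
      sym[of U X] sym[of U Y] sym[of V X] sym[of V Y]
    by (simp add: algebra_simps)
  have split: "R (D X1) X2 X3 X4 + R X1 (D X2) X3 X4 + R X1 X2 (D X3) X4 + R X1 X2 X3 (D X4) =
      (S (D X1) X4 + S X1 (D X4)) * S X2 X3 + S X1 X4 * (S (D X2) X3 + S X2 (D X3))
      - (S (D X1) X3 + S X1 (D X3)) * S X2 X4 - S X1 X3 * (S (D X2) X4 + S X2 (D X4))" for D
    by (simp add: R_eq algebra_simps)
  have "R (?\<B> X1) X2 X3 X4 + R X1 (?\<B> X2) X3 X4 + R X1 X2 (?\<B> X3) X4 + R X1 X2 X3 (?\<B> X4) =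
      L * (R (?W X1) X2 X3 X4 + R X1 (?W X2) X3 X4 + R X1 X2 (?W X3) X4 + R X1 X2 X3 (?W X4))"
    unfolding split * by (simp add: algebra_simps)
  then show ?thesis
    by (simp add: curvature_dot_def tachibana_def endo_action_def algebra_simps)
qed

text \<open>One product in \<open>R (e j) X Y (e j)\<close> contracts to the trace; the other
  collapses by expanding \<open>A Y\<close> in the basis.\<close>

lemma ricci_R: "ricci h R X Y = tr * S X Y - S X (A Y)"
proof (rule ricci_eq_sum)
  fix e assume e: "orthonormal_basis h e"
  have "h (e j) (e j) * R (e j) X Y (e j) =
      h (e j) (e j) * S (e j) (e j) * S X Y - h (e j) (e j) * h (A Y) (e j) * S X (e j)" for j
    by (simp add: R_eq algebra_simps S_def self_adjoint sym[of "A Y"])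
  then have "(\<Sum>j\<in>UNIV. h (e j) (e j) * R (e j) X Y (e j)) =
      tr * S X Y - (\<Sum>j\<in>UNIV. h (e j) (e j) * h (A Y) (e j) * S X (e j))"
    by (simp add: sum_subtractf trace_eq_sum[OF e] flip: sum_distrib_right)
  also have "(\<Sum>j\<in>UNIV. h (e j) (e j) * h (A Y) (e j) * S X (e j)) =
      (\<Sum>j\<in>UNIV. h (e j) (e j) * h (A Y) (e j) * h (e j) (A X))"
    by (simp only: S_sym[of X "e _"]) (simp only: S_def)
  also have "\<dots> = h (\<Sum>j\<in>UNIV. (h (e j) (e j) * h (A Y) (e j)) *\<^sub>R e j) (A X)"
    by (simp add: form_simps)
  also have "\<dots> = h (A Y) (A X)"
    by (simp flip: orthonormal_basis_expansion[OF e, of "A Y"])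
  also have "\<dots> = S X (A Y)"
    by (simp only: S_sym[of X "A Y"]) (simp only: S_def)
  finally show "(\<Sum>j\<in>UNIV. h (e j) (e j) * R (e j) X Y (e j)) = tr * S X Y - S X (A Y)" .
qed

text \<open>By \<open>S_square\<close> the coefficient of \<open>S\<close> becomes
  \<open>(real CARD('n) - 2) * \<rho>\<close>, and that of \<open>h\<close> is
  \<open>L - \<rho> * (tr - \<rho>)\<close>, which is -\<rho> times the former.\<close>

lemma ricci_minus_scalar:
  "ricci h R X Y - \<rho> * (tr - \<rho>) * h X Y = (real CARD('n) - 2) * \<rho> * (S X Y - \<rho> * h X Y)"
  unfolding ricci_R S_square L_def by (simp add: algebra_simps)

text \<open>Both assumptions serve to make the factor \<open>(real CARD('n) - 2) * \<rho>\<close>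
  nonzero.\<close>

lemma form_rank_ricci:
  assumes "CARD('n) \<ge> 3" "\<rho> \<noteq> 0"
  shows "form_rank (\<lambda>X Y. ricci h R X Y - \<rho> * (tr - \<rho>) * h X Y)
    = form_rank (\<lambda>X Y. S X Y - \<rho> * h X Y)"
  unfolding ricci_minus_scalar using assms by (intro form_rank_scale) auto

end

section \<open>Gauss and Weingarten formulas in a chart\<close>

text \<open>The image of \<open>D\<close> is a hyperplane; its normal vector, rescaled to take the
  value 1 on \<zeta>, is the conormal.\<close>

lemma transversal_functional:
  fixes D :: "real^'n::finite \<Rightarrow> 'n affine_space"
  assumes D: "linear D" "inj D" and \<zeta>: "\<zeta> \<notin> range D"
  obtains a where "a \<bullet> \<zeta> = 1" "\<And>w. a \<bullet> w = 0 \<longleftrightarrow> w \<in> range D"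
proof -
  have sub: "subspace (range D)" using D(1) by (simp add: linear_subspace_image)
  have "dim (range D) = CARD('n)"
    using dim_image_eq[of D UNIV] D by simp
  then have dim: "dim (range D) = DIM('n affine_space) - 1" by simp
  then have "dim (range D) < DIM('n affine_space)" by simp
  then obtain b where b: "b \<noteq> 0" "span (range D) \<subseteq> {x. b \<bullet> x = 0}"
    using lowdim_subset_hyperplane by blast
  have "range D = {x. b \<bullet> x = 0}"
    using b dim dim_hyperplane[OF b(1)]
    by (intro subspace_dim_equal sub subspace_hyperplane) (auto intro: span_base)
  then have w: "b \<bullet> w = 0 \<longleftrightarrow> w \<in> range D" for w by auto
  show thesis
    by (rule that[of "(1 / (b \<bullet> \<zeta>)) *\<^sub>R b"]) (use w \<zeta> in auto)
qed

text \<open>Pairing the Gauss formula with \<open>a\<close> kills the tangential part and leaves the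
  coefficient of \<zeta>.\<close>

lemma affine_fundamental_form_eq:
  assumes a: "a \<bullet> \<zeta> = 1" "\<And>w. a \<bullet> w = 0 \<longleftrightarrow> w \<in> range (dir_deriv f u)"
  shows "affine_fundamental_form f \<zeta> u X Y = a \<bullet> dir_deriv (\<lambda>v. dir_deriv f v Y) u X"
  unfolding affine_fundamental_form_def
proof (rule the_equality)
  let ?w = "dir_deriv (\<lambda>v. dir_deriv f v Y) u X"
  have "a \<bullet> (?w - (a \<bullet> ?w) *\<^sub>R \<zeta>) = 0" by (simp add: inner_diff_right a(1))
  then obtain Z where "?w - (a \<bullet> ?w) *\<^sub>R \<zeta> = dir_deriv f u Z" using a(2) by blast
  then show "\<exists>Z. ?w = dir_deriv f u Z + (a \<bullet> ?w) *\<^sub>R \<zeta>" by (metis diff_add_cancel)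
next
  fix c assume "\<exists>Z. dir_deriv (\<lambda>v. dir_deriv f v Y) u X = dir_deriv f u Z + c *\<^sub>R \<zeta>"
  then obtain Z where Z: "dir_deriv (\<lambda>v. dir_deriv f v Y) u X = dir_deriv f u Z + c *\<^sub>R \<zeta>" ..
  have "a \<bullet> dir_deriv f u Z = 0" using a(2) by blast
  then show "c = a \<bullet> dir_deriv (\<lambda>v. dir_deriv f v Y) u X"
    unfolding Z by (simp add: inner_add_right a(1))
qed

text \<open>Since \<open>g 0 = 0\<close>, the difference quotient is \<open>c t\<close> times that
  of \<open>g\<close>, so continuity of \<open>c\<close> suffices.\<close>

lemma DERIV_continuous_mult_zero:
  fixes c g :: "real \<Rightarrow> real"
  assumes "isCont c 0" "(g has_real_derivative m) (at 0)" "g 0 = 0"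
  shows "((\<lambda>t. c t * g t) has_real_derivative c 0 * m) (at 0)"
proof -
  have "(\<lambda>t. c t * ((g t - g 0) / (t - 0))) \<midarrow>0\<rightarrow> c 0 * m"
    using assms(1,2) by (intro tendsto_mult) (simp_all add: isCont_def has_field_derivative_iff)
  then show ?thesis by (simp add: has_field_derivative_iff assms(3))
qed

lemma smooth_on_line_derivative:
  assumes "smooth_on F U" "open U" "u \<in> U"
  shows "((\<lambda>t. a \<bullet> F (u + t *\<^sub>R X)) has_real_derivative a \<bullet> dir_deriv F u X) (at 0)"
proof -
  have F: "(F has_derivative dir_deriv F u) (at (u + 0 *\<^sub>R X))"
    using smooth_on_differentiable[OF assms] by simp
  have "((\<lambda>t. u + t *\<^sub>R X) has_derivative (\<lambda>t. t *\<^sub>R X)) (at 0)"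
    by (auto intro!: derivative_eq_intros)
  from has_derivative_inner_right[OF has_derivative_compose[OF this F], of a]
  have "((\<lambda>t. a \<bullet> F (u + t *\<^sub>R X)) has_derivative (\<lambda>t. a \<bullet> dir_deriv F u (t *\<^sub>R X))) (at 0)" .
  moreover have "linear (dir_deriv F u)"
    using F by (rule has_derivative_linear)
  ultimately show ?thesis
    by (simp add: has_field_derivative_def linear_cmul mult_commute_abs)
qed

section \<open>The Blaschke structure in one chart\<close>

locale blaschke_chart =
  fixes M :: "('n::finite) affine_space set" and \<xi> U f
  assumes nondeg: "nondegenerate_hypersurface M"
    and normal: "affine_normal M \<xi>"
    and chart: "local_parametrization M U f"
begin

abbreviation "h \<equiv> blaschke_metric \<xi> f"
abbreviation "A \<equiv> shape_operator \<xi> f"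

lemma open_U: "open U" and smooth_f: "smooth_on f U"
  and inj_df: "u \<in> U \<Longrightarrow> inj (dir_deriv f u)"
  using chart by (auto simp: local_parametrization_def)

lemma smooth_normal: "smooth_on (\<xi> \<circ> f) U"
  and transversal: "u \<in> U \<Longrightarrow> \<xi> (f u) \<notin> range (dir_deriv f u)"
  and equiaffine: "u \<in> U \<Longrightarrow> dir_deriv (\<xi> \<circ> f) u X \<in> range (dir_deriv f u)"
  using normal chart by (auto simp: affine_normal_def)

lemma linear_df: "u \<in> U \<Longrightarrow> linear (dir_deriv f u)"
  by (rule has_derivative_linear[OF smooth_on_differentiable[OF smooth_f open_U]])

lemma linear_dxi: "u \<in> U \<Longrightarrow> linear (dir_deriv (\<xi> \<circ> f) u)"
  by (rule has_derivative_linear[OF smooth_on_differentiable[OF smooth_normal open_U]])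

lemma linear_ddf: "u \<in> U \<Longrightarrow> linear (dir_deriv (\<lambda>v. dir_deriv f v Y) u)"
  by (rule has_derivative_linear[OF smooth_on_differentiable[OF smooth_on_dir_deriv[OF smooth_f] open_U]])

lemma conormal:
  assumes "u \<in> U"
  obtains a where "\<And>w. a \<bullet> w = 0 \<longleftrightarrow> w \<in> range (dir_deriv f u)"
    "\<And>X Y. h u X Y = a \<bullet> dir_deriv (\<lambda>v. dir_deriv f v Y) u X"
proof -
  obtain a where a: "a \<bullet> \<xi> (f u) = 1" "\<And>w. a \<bullet> w = 0 \<longleftrightarrow> w \<in> range (dir_deriv f u)"
    using transversal_functional[OF linear_df[OF assms] inj_df[OF assms] transversal[OF assms]] by blast
  show thesis
    by (rule that[OF a(2)]) (auto simp: blaschke_metric_def affine_fundamental_form_eq[OF a])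
qed

lemma scalar_product_metric:
  assumes u: "u \<in> U"
  shows "scalar_product (h u)"
proof
  obtain a where h: "\<And>X Y. h u X Y = a \<bullet> dir_deriv (\<lambda>v. dir_deriv f v Y) u X"
    using conormal[OF u] by metis
  show sym: "h u X Y = h u Y X" for X Y
    unfolding h using dir_deriv_commute[OF smooth_f open_U u] by simp
  \<comment> \<open>The first slot is a direction of differentiation, hence linear; the second
    inherits this by symmetry.\<close>
  have lin: "linear (\<lambda>X. h u X Y)" for Y
    unfolding h using linear_ddf[OF u]
    by (simp add: linear_iff inner_add_right)
  moreover have "linear (h u X)" for X
    using lin[of X] by (simp add: sym[of X, abs_def] flip: sym)
  ultimately show "bilinear (h u)" by (simp add: bilinear_def)
  have "f u \<in> M" using chart u by (auto simp: local_parametrization_def dest: openin_imp_subset)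
  moreover have "parametrized_at M (f u) f u" using chart u by (auto simp: parametrized_at_def)
  ultimately show "nondegenerate_form (h u)"
    using nondeg transversal[OF u] by (simp add: nondegenerate_hypersurface_def blaschke_metric_def)
qed

text \<open>Equiaffinity gives existence and injectivity of \<open>dir_deriv f u\<close> uniqueness,
  so \<open>THE\<close> is well defined.\<close>

lemma weingarten:
  assumes u: "u \<in> U"
  shows "dir_deriv (\<xi> \<circ> f) u X = - dir_deriv f u (A u X)"
proof -
  obtain Z where "dir_deriv (\<xi> \<circ> f) u X = dir_deriv f u Z" using equiaffine[OF u] by blast
  then have Z: "dir_deriv (\<xi> \<circ> f) u X = - dir_deriv f u (- Z)"
    by (simp add: linear_neg[OF linear_df[OF u]])
  show ?thesis unfolding shape_operator_def
    by (rule theI[where a = "- Z"]) (use Z inj_df[OF u] in \<open>auto simp: inj_def\<close>)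
qed

lemma linear_shape_operator:
  assumes u: "u \<in> U"
  shows "linear (A u)"
proof (rule linearI)
  note lin = linear_add[OF linear_df[OF u]] linear_add[OF linear_dxi[OF u]]
    linear_cmul[OF linear_df[OF u]] linear_cmul[OF linear_dxi[OF u]]
  have w: "dir_deriv f u (A u X) = - dir_deriv (\<xi> \<circ> f) u X" for X
    by (simp add: weingarten[OF u])
  show "A u (X + Y) = A u X + A u Y" for X Y
    by (rule injD[OF inj_df[OF u]]) (simp only: w lin minus_add_distrib)
  show "A u (c *\<^sub>R X) = c *\<^sub>R A u X" for c X
    by (rule injD[OF inj_df[OF u]]) (simp only: w lin scaleR_minus_right)
qed

lemma linear_df_expand:
  assumes "v \<in> U"
  shows "dir_deriv f v Z = (\<Sum>i\<in>UNIV. Z $ i *\<^sub>R dir_deriv f v (axis i 1))"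
proof -
  have "dir_deriv f v Z = dir_deriv f v (\<Sum>i\<in>UNIV. Z $ i *\<^sub>R axis i 1)"
    using basis_expansion[of Z] by (simp add: scalar_mult_eq_scaleR)
  then show ?thesis
    by (simp add: linear_sum[OF linear_df[OF assms]] linear_cmul[OF linear_df[OF assms]])
qed

text \<open>Applied to \<open>A v Y - A u Y\<close>, the map \<open>dir_deriv f v\<close> gives a
  vector tending to 0 by the Weingarten formula, while near \<open>u\<close> these maps are
  uniformly bounded below.\<close>

lemma isCont_shape_operator:
  assumes u: "u \<in> U"
  shows "isCont (\<lambda>v. A v Y) u"
proof -
  obtain B where B: "B > 0" "\<And>Z. B * norm Z \<le> norm (dir_deriv f u Z)"
    using linear_inj_bounded_below_pos[OF linear_df[OF u] inj_df[OF u]] by blast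
  \<comment> \<open>\<open>N\<close> controls how far \<open>dir_deriv f v\<close> is from
    \<open>dir_deriv f u\<close>; \<open>r\<close> is the error of \<open>A u Y\<close> in the
    Weingarten formula at \<open>v\<close>.\<close>
  define N where "N v = (\<Sum>i\<in>UNIV. norm (dir_deriv f v (axis i 1) - dir_deriv f u (axis i 1)))" for v
  define r where "r v = norm (dir_deriv (\<xi> \<circ> f) v Y + dir_deriv f v (A u Y))" for v
  have cont_df: "(\<lambda>v. dir_deriv f v Z) \<midarrow>u\<rightarrow> dir_deriv f u Z" for Z
    using smooth_on_isCont[OF smooth_on_dir_deriv[OF smooth_f] open_U u] by (simp add: isCont_def)
  have cont_dxi: "(\<lambda>v. dir_deriv (\<xi> \<circ> f) v Y) \<midarrow>u\<rightarrow> dir_deriv (\<xi> \<circ> f) u Y"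
    using smooth_on_isCont[OF smooth_on_dir_deriv[OF smooth_normal] open_U u] by (simp only: isCont_def)
  have "N \<midarrow>u\<rightarrow> (\<Sum>i\<in>(UNIV::'n set). norm (dir_deriv f u (axis i 1) - dir_deriv f u (axis i 1)))"
    unfolding N_def by (intro tendsto_sum tendsto_norm tendsto_diff cont_df tendsto_const)
  then have "N \<midarrow>u\<rightarrow> 0" by simp
  then have N_small: "\<forall>\<^sub>F v in at u. N v < B / 2"
    using B(1) by (intro order_tendstoD(2)[where y = 0]) auto
  have "r \<midarrow>u\<rightarrow> norm (dir_deriv (\<xi> \<circ> f) u Y + dir_deriv f u (A u Y))"
    unfolding r_def by (intro tendsto_norm tendsto_add cont_df cont_dxi)
  then have "r \<midarrow>u\<rightarrow> 0" by (simp add: weingarten[OF u])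
  then have r0: "(\<lambda>v. 2 / B * r v) \<midarrow>u\<rightarrow> 0" by (rule tendsto_mult_right_zero)
  have "\<forall>\<^sub>F v in at u. v \<in> U"
    using open_U u by (rule eventually_at_in_open')
  with N_small have "\<forall>\<^sub>F v in at u. norm (A v Y - A u Y) \<le> 2 / B * r v"
  proof eventually_elim
    case (elim v)
    define W where "W = A v Y - A u Y"
    have "dir_deriv f v W - dir_deriv f u W
        = (\<Sum>i\<in>UNIV. W $ i *\<^sub>R (dir_deriv f v (axis i 1) - dir_deriv f u (axis i 1)))"
      using linear_df_expand[OF elim(2), of W] linear_df_expand[OF u, of W]
      by (simp add: scaleR_diff_right sum_subtractf)
    also have "norm \<dots> \<le> (\<Sum>i\<in>UNIV. norm W * norm (dir_deriv f v (axis i 1) - dir_deriv f u (axis i 1)))"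
      using component_le_norm_cart[of W] by (intro sum_norm_le) (simp add: mult_right_mono)
    also have "\<dots> = norm W * N v" by (simp add: N_def sum_distrib_left)
    also have "\<dots> \<le> norm W * (B / 2)" using elim(1) by (intro mult_left_mono) auto
    finally have 1: "norm (dir_deriv f v W - dir_deriv f u W) \<le> norm W * (B / 2)" .
    have "dir_deriv f v W = - (dir_deriv (\<xi> \<circ> f) v Y + dir_deriv f v (A u Y))"
      by (simp add: W_def linear_diff[OF linear_df[OF elim(2)]] weingarten[OF elim(2)])
    then have "norm (dir_deriv f v W) = r v" by (simp only: r_def norm_minus_cancel)
    moreover have "norm (dir_deriv f u W) \<le> norm (dir_deriv f v W) + norm (dir_deriv f v W - dir_deriv f u W)"
      using norm_triangle_ineq4[of "dir_deriv f v W" "dir_deriv f v W - dir_deriv f u W"] by simp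
    \<comment> \<open>With \<open>N v < B / 2\<close>, half of the lower bound absorbs the
      perturbation.\<close>
    ultimately have "B * norm W \<le> r v + norm W * (B / 2)"
      using 1 B(2)[of W] by linarith
    also have "norm W * (B / 2) = B * norm W / 2" by simp
    finally have "norm W * B \<le> 2 * r v" by (simp add: mult.commute[of "norm W"])
    then show ?case using B(1) by (simp add: W_def[symmetric] pos_le_divide_eq)
  qed
  then have "((\<lambda>v. A v Y - A u Y) \<longlongrightarrow> 0) (at u)"
    by (rule Lim_null_comparison[OF _ r0])
  then show ?thesis unfolding isCont_def by (rule LIM_zero_cancel)
qed

text \<open>
  With \<open>a\<close> the conormal at \<open>u\<close>, differentiating \<open>a \<bullet> D\<xi> Y = - a \<bullet> Df (\<S> Y)\<close> at \<open>u\<close> needs only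
  the continuity of the shape operator, because \<open>a \<bullet> Df\<close> vanishes at \<open>u\<close>.
\<close>

lemma shape_form_eq_second_derivative:
  assumes u: "u \<in> U"
    and a: "\<And>w. a \<bullet> w = 0 \<longleftrightarrow> w \<in> range (dir_deriv f u)"
    and h: "\<And>X Y. h u X Y = a \<bullet> dir_deriv (\<lambda>v. dir_deriv f v Y) u X"
  shows "h u X (A u Y) = - (a \<bullet> dir_deriv (\<lambda>v. dir_deriv (\<xi> \<circ> f) v Y) u X)"
proof -
  interpret scalar_product "h u" by (rule scalar_product_metric[OF u])
  define p where "p t = u + t *\<^sub>R X" for t
  have p0: "p 0 = u" and cont_p: "isCont p 0"
    by (simp_all add: p_def[abs_def])
  have "\<forall>\<^sub>F v in nhds u. v \<in> U" by (rule eventually_nhds_in_open[OF open_U u])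
  moreover have "(p \<longlongrightarrow> p 0) (nhds 0)"
    using cont_p unfolding isCont_def by (rule iffD1[OF tendsto_at_iff_tendsto_nhds])
  ultimately have ev: "\<forall>\<^sub>F t in nhds 0. p t \<in> U"
    unfolding p0 filterlim_iff by blast
  have dxi: "((\<lambda>t. a \<bullet> dir_deriv (\<xi> \<circ> f) (p t) Y) has_real_derivative
      a \<bullet> dir_deriv (\<lambda>v. dir_deriv (\<xi> \<circ> f) v Y) u X) (at 0)"
    unfolding p_def by (rule smooth_on_line_derivative[OF smooth_on_dir_deriv[OF smooth_normal] open_U u])
  \<comment> \<open>In coordinates the tangential term is a sum of products, each with a continuous
    factor and a differentiable factor vanishing at 0.\<close>
  have "isCont (\<lambda>t. A (p t) Y $ i) 0" for i
    using isCont_o2[OF cont_p, of "\<lambda>v. A v Y"] isCont_shape_operator[OF u, of Y] p0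
    by (auto intro: continuous_component)
  moreover have "((\<lambda>t. a \<bullet> dir_deriv f (p t) (axis i 1)) has_real_derivative h u X (axis i 1)) (at 0)" for i
    unfolding h p_def by (rule smooth_on_line_derivative[OF smooth_on_dir_deriv[OF smooth_f] open_U u])
  moreover have "a \<bullet> dir_deriv f (p 0) (axis i 1) = 0" for i
    using a p0 by auto
  ultimately have "((\<lambda>t. A (p t) Y $ i * (a \<bullet> dir_deriv f (p t) (axis i 1))) has_real_derivative
      A (p 0) Y $ i * h u X (axis i 1)) (at 0)" for i
    by (rule DERIV_continuous_mult_zero)
  then have "((\<lambda>t. - (\<Sum>i\<in>UNIV. A (p t) Y $ i * (a \<bullet> dir_deriv f (p t) (axis i 1)))) has_real_derivative
      - (\<Sum>i\<in>UNIV. A (p 0) Y $ i * h u X (axis i 1))) (at 0)"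
    by (intro DERIV_minus DERIV_sum)
  moreover have "(\<Sum>i\<in>UNIV. A u Y $ i * h u X (axis i 1)) = h u X (A u Y)"
  proof -
    have "h u X (A u Y) = h u X (\<Sum>i\<in>UNIV. A u Y $ i *\<^sub>R axis i 1)"
      using basis_expansion[of "A u Y"] by (simp add: scalar_mult_eq_scaleR)
    then show ?thesis by (simp add: linear_sum[OF linear_right] scale_right)
  qed
  moreover have "\<forall>\<^sub>F t in nhds 0. a \<bullet> dir_deriv (\<xi> \<circ> f) (p t) Y
      = - (\<Sum>i\<in>UNIV. A (p t) Y $ i * (a \<bullet> dir_deriv f (p t) (axis i 1)))"
    using ev
  proof eventually_elim
    case (elim t)
    show ?case
      using linear_df_expand[OF elim, of "A (p t) Y"] by (simp add: weingarten[OF elim] inner_sum_right)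
  qed
  ultimately have "((\<lambda>t. a \<bullet> dir_deriv (\<xi> \<circ> f) (p t) Y) has_real_derivative - h u X (A u Y)) (at 0)"
    using p0 by (simp add: DERIV_cong_ev[OF refl _ refl])
  from DERIV_unique[OF this dxi] show ?thesis by simp
qed

text \<open>Self-adjointness is the symmetry of the second derivative of
  \<open>\<xi> \<circ> f\<close>, combined with that of \<open>h u\<close>.\<close>

lemma shape_space:
  assumes u: "u \<in> U"
  shows "shape_space (h u) (A u)"
proof -
  interpret scalar_product "h u" by (rule scalar_product_metric[OF u])
  obtain a where a: "\<And>w. a \<bullet> w = 0 \<longleftrightarrow> w \<in> range (dir_deriv f u)"
    and h: "\<And>X Y. h u X Y = a \<bullet> dir_deriv (\<lambda>v. dir_deriv f v Y) u X"
    using conormal[OF u] by metis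
  have "h u X (A u Y) = h u Y (A u X)" for X Y
    unfolding shape_form_eq_second_derivative[OF u a h]
    using dir_deriv_commute[OF smooth_normal open_U u] by simp
  then have "h u X (A u Y) = h u (A u X) Y" for X Y
    using sym by metis
  then show ?thesis
    by (intro shape_space.intro shape_space_axioms.intro scalar_product_metric[OF u] linear_shape_operator[OF u])
qed

end

section \<open>Transfer from the tangent-space algebra to the hypersurface\<close>

theorem theorem6p4:
  fixes M :: "('n::finite) affine_space set"
    and \<xi> :: "'n affine_space \<Rightarrow> 'n affine_space"
    and \<rho> :: "'n affine_space \<Rightarrow> real"
  assumes "CARD('n) \<ge> 3"
    and "nondegenerate_hypersurface M"
    and "affine_normal M \<xi>"
    and "\<forall>x\<in>M. affine_quasi_umbilical_at M \<xi> x"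
    and "\<forall>x\<in>M. rank_one_at M \<xi> x (\<rho> x)"
  shows "\<forall>x\<in>M. \<forall>f u. parametrized_at M x f u \<longrightarrow>
    (let h = blaschke_metric \<xi> f u;
         S = shape_form \<xi> f u;
         R = opozda_verstraelen \<xi> f u;
         tr = tr_shape \<xi> f u;
         L = \<rho> x * (tr - (real CARD('n) - 1) * \<rho> x)
     in (\<forall>X1 X2 X3 X4 X Y.
           curvature_dot h R R X1 X2 X3 X4 X Y = L * tachibana h R X1 X2 X3 X4 X Y) \<and>
        (\<rho> x \<noteq> 0 \<longrightarrow>
           form_rank (\<lambda>X Y. ricci h R X Y - \<rho> x * (tr - \<rho> x) * h X Y)
             = form_rank (\<lambda>X Y. S X Y - \<rho> x * h X Y) \<and>
           form_rank (\<lambda>X Y. S X Y - \<rho> x * h X Y) = 1))"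
proof (intro ballI allI impI)
  fix x f u assume x: "x \<in> M" and f: "parametrized_at M x f u"
  then obtain U where U: "local_parametrization M U f" "u \<in> U"
    by (auto simp: parametrized_at_def)
  interpret blaschke_chart M \<xi> U f
    by unfold_locales (use assms U in auto)
  \<comment> \<open>\<open>S\<close> and \<open>R\<close> must first be identified with the
    geometric tensors; only then does the rank hypothesis yield the quasi-umbilical
    structure.\<close>
  interpret shape_space "h u" "A u" by (rule shape_space[OF U(2)])
  have S: "S = shape_form \<xi> f u"
    by (intro ext) (simp add: S_def shape_form_def)
  have R: "R = opozda_verstraelen \<xi> f u"
    by (intro ext) (simp add: R_def opozda_verstraelen_def S)
  have rank: "form_rank (\<lambda>X Y. S X Y - \<rho> x * h u X Y) = 1"
    using assms(5) x f unfolding rank_one_at_def S by blast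
  interpret quasi_umbilical_space "h u" "A u" "\<rho> x"
    by unfold_locales (rule rank)
  have tr: "tr = tr_shape \<xi> f u"
    by (simp add: tr_def tr_shape_def)
  show "let h = blaschke_metric \<xi> f u;
         S = shape_form \<xi> f u;
         R = opozda_verstraelen \<xi> f u;
         tr = tr_shape \<xi> f u;
         L = \<rho> x * (tr - (real CARD('n) - 1) * \<rho> x)
     in (\<forall>X1 X2 X3 X4 X Y.
           curvature_dot h R R X1 X2 X3 X4 X Y = L * tachibana h R X1 X2 X3 X4 X Y) \<and>
        (\<rho> x \<noteq> 0 \<longrightarrow>
           form_rank (\<lambda>X Y. ricci h R X Y - \<rho> x * (tr - \<rho> x) * h X Y)
             = form_rank (\<lambda>X Y. S X Y - \<rho> x * h X Y) \<and>
           form_rank (\<lambda>X Y. S X Y - \<rho> x * h X Y) = 1)"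
    unfolding Let_def S[symmetric] R[symmetric] tr[symmetric] L_def[symmetric]
    using curvature_dot_R form_rank_ricci[OF assms(1)] rank by blast
qed

end
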